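(* Let $\mathcal H$ be a real Hilbert space, let $\mathcal X_n$ ($n\ge1$) be linear subspaces of $\mathcal H$, let $\mathcal E$ be a metric space, let $\Upsilon:\mathcal H\to\mathcal E$ and $\Upsilon_n:\mathcal X_n\to\mathcal E$ be maps, and let $\Phi:\mathcal E\to\mathbb R$ be continuous. Assume: (1) (Compactness and weak stability) (i) For every $R>0$ the set $\{\Upsilon_n(h): h\in\mathcal X_n,\ \|h\|_{\mathcal H}\le R,\ n\ge1\}$ is relatively compact in $\mathcal E$; (ii) whenever $n_j\to+\infty$ and $h_j\in\mathcal X_{n_j}$ satisfy $h_j\rightharpoonup h$ weakly in $\mathcal H$, one has $\Upsilon_{n_j}(h_j)\to\Upsilon(h)$ in $\mathcal E$. (2) (Control approximation) There are operators $Q_n:\mathcal H\to\mathcal X_n$, $n\ge 1$, such that $Q_nh\to h$ in $\mathcal H$ as $n\to\infty$ for every $h\in\mathcal H$. (3) (Directional equicontinuity) Whenever $h_n^0\in\mathcal X_n$, $h\in\mathcal H$ and $h_n^0\to h$ in $\mathcal H$, then for every $q\in\mathcal H$, with $q_n:=Q_nq$, and every $a_0>0$, the family of maps $a\mapsto\Phi(\Upsilon_n(h_n^0+aq_n))$, $n\ge1$, is equicontinuous on $[-a_0,a_0]$. (4) (Local terminal nondegeneracy) The map $\mathcal T:\mathcal H\to\mathbb R$, $\mathcal T(h):=\Phi(\Upsilon(h))$, is $C^1$ on $\mathcal H$, and for every $h\in\mathcal H$ there is $q_h\in\mathcal H$ with $D\mathcal T(h)[q_h]\neq0$. For $y\in\mathbb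 R$ set $$I(y):=\inf_{\{h\in\mathcal H:\ \Phi(\Upsilon(h))=y\}}\tfrac12\|h\|_{\mathcal H}^2,\qquad \widehat I^n(y):=\inf_{\{h_n\in\mathcal X_n:\ \Phi(\Upsilon_n(h_n))=y\}}\tfrac12\|h_n\|_{\mathcal H}^2 .$$ Then for every $y\in\mathbb R$, $\widehat I^n(y)\to I(y)$ as $n\to\infty$.
   Context: The infimum over the empty set is $+\infty$, and convergence is in $[0,+\infty]$. $D\mathcal T(h)[q]$ denotes the (Fréchet) derivative of $\mathcal T$ at $h$ in direction $q$. Equivalently, $I(y)=\inf_{f\in\mathcal E}\mathcal J_y(f)$ and $\widehat I^n(y)=\inf_{f\in\mathcal E}\mathcal J^n_y(f)$, where $\mathcal J_y(f)=\inf\{\frac12\|h\|_{\mathcal H}^2: h\in\mathcal H,\ \Upsilon(h)=f,\ \Phi(f)=y\}$ and $\mathcal J_y^n(f)=\inf\{\frac12\|h_n\|_{\mathcal H}^2: h_n\in\mathcal X_n,\ \Upsilon_n(h_n)=f,\ \Phi(f)=y\}$. *)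

theory Defs
  imports "HOL-Analysis.Analysis"
begin

definition weakly_tendsto :: "(nat \<Rightarrow> 'h::real_inner) \<Rightarrow> 'h \<Rightarrow> bool" where
  "weakly_tendsto h l \<longleftrightarrow> (\<forall>g. (\<lambda>j. inner (h j) g) \<longlonglongrightarrow> inner l g)"

definition relatively_compact :: "'e::metric_space set \<Rightarrow> bool" where
  "relatively_compact S \<longleftrightarrow> compact (closure S)"

definition equicontinuous_family_on ::
  "'a::metric_space set \<Rightarrow> 'i set \<Rightarrow> ('i \<Rightarrow> 'a \<Rightarrow> 'b::metric_space) \<Rightarrow> bool" where
  "equicontinuous_family_on S N F \<longleftrightarrow>
     (\<forall>a\<in>S. \<forall>\<epsilon>>0. \<exists>\<delta>>0. \<forall>n\<in>N. \<forall>b\<in>S. dist b a < \<delta> \<longrightarrow> dist (F n b) (F n a) < \<epsilon>)"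

(* Continuity of the derivative is with respect to the operator norm on bounded linear maps. *)
definition continuously_differentiable ::
  "('h::real_normed_vector \<Rightarrow> 'b::real_normed_vector) \<Rightarrow> bool" where
  "continuously_differentiable T \<longleftrightarrow>
     (\<exists>DT :: 'h \<Rightarrow> 'h \<Rightarrow>\<^sub>L 'b.
        (\<forall>h. (T has_derivative blinfun_apply (DT h)) (at h)) \<and> continuous_on UNIV DT)"

(* Minimal energy of a control in X whose output under S has observable value y.
   The infimum is taken in [0,\<infinity>], so it is \<infinity> when no control in X attains y.
   S is a total function, but only its values on X matter. *)
definition min_energy ::
  "'h::real_normed_vector set \<Rightarrow> ('h \<Rightarrow> 'e) \<Rightarrow> ('e \<Rightarrow> real) \<Rightarrow> real \<Rightarrow> ennreal" where
  "min_energy X S \<Phi> y = (INF h \<in> {h \<in> X. \<Phi> (S h) = y}. ennreal (1/2 * (norm h)\<^sup>2))"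

end

theory Submission
  imports Defs
begin

text \<open>
  Lower bound: controls of energy below \<open>c\<close> reaching \<open>y\<close> along a subsequence have a weakly convergent
  subsequence; by weak stability its limit reaches \<open>y\<close>, and its energy is at most \<open>c\<close>.

  Upper bound: if \<open>h\<close> reaches \<open>y\<close> and \<open>p\<close> is a direction of increase of \<open>\<Phi> \<circ> \<Upsilon>\<close> at \<open>h\<close>, then for small
  \<open>a > 0\<close> the limit values at \<open>h - a p\<close> and \<open>h + a p\<close> lie strictly on either side of \<open>y\<close>. For large \<open>n\<close>
  this persists at \<open>Q\<^sub>n h \<plusminus> a Q\<^sub>n p\<close>, so the intermediate value theorem gives a control in \<open>X\<^sub>n\<close> that
  reaches \<open>y\<close> exactly, at an energy close to that of \<open>h\<close>.
\<close>

section \<open>Weak sequential compactness of bounded sequences in a Hilbert space\<close>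

text \<open>The infima \<open>d m\<close> of the squared norm over \<open>K m\<close> increase and
  stay bounded, hence converge. By the parallelogram law, near-minimisers \<open>x m\<close> are
  then Cauchy, and their limit lies in every \<open>K m\<close>.\<close>

lemma nested_closed_convex_Inter_nonempty:
  fixes K :: "nat \<Rightarrow> 'h::{real_inner, complete_space} set"
  assumes nonempty: "\<And>m. K m \<noteq> {}"
    and closed: "\<And>m. closed (K m)"
    and convex: "\<And>m. convex (K m)"
    and dec: "decseq K"
    and bounded: "bounded (K 0)"
  shows "\<Inter> (range K) \<noteq> {}"
proof -
  define d where "d m = (INF z\<in>K m. (norm z)\<^sup>2)" for m
  have bdd: "bdd_below ((\<lambda>z. (norm z)\<^sup>2) ` K m)" for m
    by (rule bdd_belowI[of _ 0]) auto
  have d_le: "d m \<le> (norm z)\<^sup>2" if "z \<in> K m" for m z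
    unfolding d_def using that bdd by (intro cINF_lower) auto
  have K_mono: "K n \<subseteq> K m" if "m \<le> n" for m n
    using dec that by (simp add: decseq_def)
  have d_mono: "d m \<le> d n" if "m \<le> n" for m n
    unfolding d_def using nonempty bdd K_mono[OF that] by (intro cINF_superset_mono) auto
  obtain B where B: "\<And>z. z \<in> K 0 \<Longrightarrow> norm z \<le> B"
    using bounded by (auto simp: bounded_iff)
  have d_bound: "d m \<le> B\<^sup>2" for m
  proof -
    obtain z where z: "z \<in> K m" using nonempty by blast
    then have "norm z \<le> B" using B K_mono[of 0 m] by auto
    then have "(norm z)\<^sup>2 \<le> B\<^sup>2" by (intro power_mono) auto
    with d_le[OF z] show ?thesis by linarith
  qed
  have "\<exists>z\<in>K m. (norm z)\<^sup>2 < d m + 1 / Suc m" for m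
    using cINF_less_iff[OF nonempty bdd, of m "d m + 1 / Suc m"] by (simp add: d_def)
  then obtain x where x: "\<And>m. x m \<in> K m" "\<And>m. (norm (x m))\<^sup>2 < d m + 1 / Suc m"
    by metis
  \<comment> \<open>The midpoint of \<open>x m\<close> and \<open>x n\<close> lies in the convex set
    \<open>K m\<close>, so its squared norm is at least \<open>d m\<close>. The two errors
    \<open>1 / Suc m\<close> and \<open>1 / Suc n\<close>, each doubled by the parallelogram law,
    add up to at most \<open>4 / Suc m\<close>.\<close>
  have step: "(norm (x m - x n))\<^sup>2 \<le> 2 * (d n - d m) + 4 / Suc m" if "m \<le> n" for m n
  proof -
    have "x n \<in> K m" using x(1) K_mono[OF that] by blast
    then have "(1/2) *\<^sub>R x m + (1/2) *\<^sub>R x n \<in> K m"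
      using convexD[OF convex x(1), of "x n" m "1/2" "1/2"] by simp
    then have "d m \<le> (norm ((1/2) *\<^sub>R (x m + x n)))\<^sup>2"
      using d_le by (simp add: scaleR_add_right)
    also have "\<dots> = (norm (x m + x n))\<^sup>2 / 4"
      by (simp add: power_divide)
    finally have mid: "4 * d m \<le> (norm (x m + x n))\<^sup>2" by simp
    have par: "(norm (x m - x n))\<^sup>2 + (norm (x m + x n))\<^sup>2
        = 2 * (norm (x m))\<^sup>2 + 2 * (norm (x n))\<^sup>2"
      by (simp add: power2_norm_eq_inner inner_diff inner_add inner_commute)
    have "1 / real (Suc n) \<le> 1 / Suc m" using that by (simp add: frac_le)
    moreover have "4 / real (Suc m) = 4 * (1 / Suc m)" by simp
    ultimately show ?thesis using mid par x(2)[of m] x(2)[of n] by argo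
  qed
  have "incseq d" using d_mono by (simp add: incseq_def)
  with d_bound have "convergent d"
    by (metis incseq_convergent convergentI)
  then have "Cauchy d" by (rule convergent_Cauchy)
  have "Cauchy x"
  proof (rule CauchyI')
    fix e :: real assume "e > 0"
    \<comment> \<open>These fractions make the bound of \<open>step\<close> come out as 2 * (e^2 /
      4) + 4 * (e^2 / 8) = e^2.\<close>
    then have e2: "e\<^sup>2 / 4 > 0" "e\<^sup>2 / 8 > 0" by auto
    obtain M where M: "\<And>m n. m \<ge> M \<Longrightarrow> n \<ge> M \<Longrightarrow> norm (d m - d n) < e\<^sup>2 / 4"
      using CauchyD[OF \<open>Cauchy d\<close> e2(1)] by blast
    obtain M' where M': "1 / real (Suc M') < e\<^sup>2 / 8"
      using nat_approx_posE[OF e2(2)] by (metis inverse_eq_divide)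
    show "\<exists>M. \<forall>m\<ge>M. \<forall>n>m. dist (x m) (x n) < e"
    proof (intro exI[of _ "max M M'"] allI impI)
      fix m n assume mn: "max M M' \<le> m" "m < n"
      have "1 / real (Suc m) \<le> 1 / Suc M'" using mn by (simp add: frac_le)
      moreover have "d n - d m < e\<^sup>2 / 4" using M[of n m] mn by (simp add: abs_if split: if_splits)
      moreover have "4 / real (Suc m) = 4 * (1 / Suc m)" by simp
      moreover have "(norm (x m - x n))\<^sup>2 \<le> 2 * (d n - d m) + 4 / Suc m"
        using step mn by simp
      ultimately have "(norm (x m - x n))\<^sup>2 < e\<^sup>2"
        using M' by argo
      with \<open>e > 0\<close> show "dist (x m) (x n) < e"
        using power_less_imp_less_base[of "norm (x m - x n)" 2 e] by (simp add: dist_norm)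
    qed
  qed
  then obtain h where h: "x \<longlonglongrightarrow> h" using Cauchy_convergent unfolding convergent_def by blast
  have "h \<in> K m" for m
  proof (rule Lim_in_closed_set[OF closed _ _ h])
    show "\<forall>\<^sub>F n in sequentially. x n \<in> K m"
      using x(1) K_mono by (intro eventually_sequentiallyI[of m]) blast
  qed simp
  then show ?thesis by blast
qed

text \<open>Closed convex sets are weakly closed, so every weak cluster point of \<open>x\<close>
  lies in all these hulls; a common point of them is the candidate for a weak limit.\<close>

definition tail_hull :: "(nat \<Rightarrow> 'h::real_inner) \<Rightarrow> nat \<Rightarrow> 'h set" where
  "tail_hull x m = closure (convex hull (x ` {m..}))"

lemma tail_hulls_Inter_nonempty:
  fixes x :: "nat \<Rightarrow> 'h::{real_inner, complete_space}"
  assumes "bounded (range x)"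
  obtains h where "\<And>m. h \<in> tail_hull x m"
proof -
  have "\<Inter> (range (tail_hull x)) \<noteq> {}"
  proof (rule nested_closed_convex_Inter_nonempty)
    show "decseq (tail_hull x)"
      unfolding decseq_def tail_hull_def by (intro allI impI closure_mono hull_mono image_mono) auto
    have "bounded (x ` {0..})" using assms by (rule bounded_subset) auto
    then show "bounded (tail_hull x 0)"
      unfolding tail_hull_def by (intro bounded_closure bounded_convex_hull)
  qed (auto simp: tail_hull_def)
  then show thesis using that by blast
qed

text \<open>A slab of half-width \<open>e\<close> around the hyperplane where
  \<open>inner g z = L\<close> is closed and convex and contains a tail of \<open>x\<close>, hence a
  whole tail hull. Then \<open>e\<close> tends to 0.\<close>

lemma inner_tail_hull_eq_lim:
  assumes "\<And>m. h \<in> tail_hull x m" and lim: "(\<lambda>j. inner (x j) g) \<longlonglongrightarrow> L"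
  shows "inner h g = L"
proof -
  have "\<bar>inner h g - L\<bar> \<le> e" if "e > 0" for e
  proof -
    define S where "S = {z. inner g z \<le> L + e} \<inter> {z. inner g z \<ge> L - e}"
    have "\<forall>\<^sub>F j in sequentially. dist (inner (x j) g) L < e"
      using lim that by (rule tendstoD)
    then obtain m where m: "\<And>j. j \<ge> m \<Longrightarrow> dist (inner (x j) g) L < e"
      by (auto simp: eventually_sequentially)
    have "x j \<in> S" if "j \<ge> m" for j
      using m[OF that] by (auto simp: S_def dist_real_def inner_commute abs_if split: if_splits)
    moreover have "convex S" "closed S"
      unfolding S_def
      by (auto intro: convex_Int convex_halfspace_le convex_halfspace_ge
          closed_Int closed_halfspace_le closed_halfspace_ge)
    ultimately have "tail_hull x m \<subseteq> S"
      unfolding tail_hull_def by (intro closure_minimal hull_minimal) auto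
    then show ?thesis using assms(1)[of m] by (auto simp: S_def inner_commute abs_if)
  qed
  then have "\<bar>inner h g - L\<bar> \<le> 0 + e" if "e > 0" for e using that by simp
  then have "\<bar>inner h g - L\<bar> \<le> 0" by (rule field_le_epsilon)
  then show ?thesis by simp
qed

text \<open>Tychonoff in place of a diagonal argument: the cube is compact, and sequentially compact
  because a countable product of copies of the reals is first countable.\<close>

lemma bounded_imp_pointwise_convergent_subseq:
  fixes f :: "nat \<Rightarrow> nat \<Rightarrow> real"
  assumes "\<And>j i. \<bar>f j i\<bar> \<le> C"
  obtains r where "strict_mono (r :: nat \<Rightarrow> nat)" "\<And>i. convergent (\<lambda>j. f (r j) i)"
proof -
  have "compact (PiE UNIV (\<lambda>_::nat. {-C..C}))"
    using compactin_PiE[of "\<lambda>_. euclidean" UNIV "\<lambda>_::nat. {-C..C}"]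
    by (simp add: euclidean_product_topology)
  then have "seq_compact (PiE UNIV (\<lambda>_::nat. {-C..C}))" by (rule compact_imp_seq_compact)
  moreover have "\<forall>j. f j \<in> PiE UNIV (\<lambda>_. {-C..C})"
    using assms by (auto simp: abs_le_iff minus_le_iff)
  ultimately obtain l r where r: "strict_mono (r :: nat \<Rightarrow> nat)" "(f \<circ> r) \<longlonglongrightarrow> l"
    by (rule seq_compactE)
  have "(\<lambda>j. (f \<circ> r) j i) \<longlonglongrightarrow> l i" for i
    by (rule continuous_on_tendsto_compose[OF continuous_on_product_coordinates r(2)]) auto
  with r(1) that show thesis by (auto simp: convergent_def)
qed

text \<open>Thin the sequence until its inner products with each \<open>x i\<close> converge. A
  common point \<open>h\<close> of the tail hulls is then the only possible weak cluster point,
  which forces weak convergence.\<close>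

lemma bounded_imp_weakly_convergent_subseq:
  fixes x :: "nat \<Rightarrow> 'h::{real_inner, complete_space}"
  assumes "bounded (range x)"
  obtains r h where "strict_mono (r :: nat \<Rightarrow> nat)" "weakly_tendsto (x \<circ> r) h"
proof -
  obtain B where B: "\<And>j. norm (x j) \<le> B" using assms by (auto simp: bounded_iff)
  have inner_le: "\<bar>inner (x j) g\<bar> \<le> B * norm g" for j g
    by (rule order_trans[OF Cauchy_Schwarz_ineq2 mult_right_mono[OF B norm_ge_zero]])
  have "B \<ge> 0" using order_trans[OF norm_ge_zero B] by simp
  then have "\<bar>inner (x j) (x i)\<bar> \<le> B * B" for j i
    using order_trans[OF inner_le mult_left_mono[OF B]] by blast
  then obtain r where r: "strict_mono (r :: nat \<Rightarrow> nat)"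
    "\<And>i. convergent (\<lambda>j. inner (x (r j)) (x i))"
    using bounded_imp_pointwise_convergent_subseq[of "\<lambda>j i. inner (x j) (x i)"] by blast
  define y where "y = x \<circ> r"
  have "bounded (range y)" using assms by (rule bounded_subset) (auto simp: y_def)
  then obtain h where h: "\<And>m. h \<in> tail_hull y m"
    using tail_hulls_Inter_nonempty by blast
  \<comment> \<open>A cluster point of a further subsequence lies in the closed span of \<open>y\<close> and has the same
    inner products with every \<open>y i\<close> as \<open>h\<close>, so it is \<open>h\<close>; this replaces Riesz representation.\<close>
  have unique: "h' = h" if s: "strict_mono (s :: nat \<Rightarrow> nat)" and h': "\<And>m. h' \<in> tail_hull (y \<circ> s) m"
    for s h'
  proof -
    have y_h: "inner (y i) (h' - h) = 0" for i
    proof -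
      obtain L where L: "(\<lambda>j. inner (y j) (y i)) \<longlonglongrightarrow> L"
        using r(2)[of "r i"] by (auto simp: convergent_def y_def)
      then have "inner h (y i) = L" by (rule inner_tail_hull_eq_lim[OF h])
      moreover have "(\<lambda>j. inner ((y \<circ> s) j) (y i)) \<longlonglongrightarrow> L"
        using LIMSEQ_subseq_LIMSEQ[OF L s] by (simp add: o_def)
      then have "inner h' (y i) = L" by (rule inner_tail_hull_eq_lim[OF h'])
      ultimately show ?thesis by (simp add: inner_diff_right inner_commute)
    qed
    have "inner h (h' - h) = 0" by (rule inner_tail_hull_eq_lim[OF h]) (simp add: y_h)
    moreover have "inner h' (h' - h) = 0" by (rule inner_tail_hull_eq_lim[OF h']) (simp add: y_h)
    ultimately have "inner (h' - h) (h' - h) = 0" by (simp add: inner_diff_left)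
    then show ?thesis by simp
  qed
  have "(\<lambda>j. inner (y j) g) \<longlonglongrightarrow> inner h g" for g
  proof (rule ccontr)
    assume "\<not> ?thesis"
    then obtain e where e: "e > 0" "\<not> (\<forall>\<^sub>F j in sequentially. dist (inner (y j) g) (inner h g) < e)"
      by (auto simp: tendsto_iff)
    \<comment> \<open>Along \<open>s\<close> the inner products with \<open>g\<close> stay at
      distance at least \<open>e\<close> from \<open>inner h g\<close>, yet by Bolzano-Weierstrass
      and \<open>unique\<close> a further subsequence converges to it.\<close>
    then obtain s where s: "strict_mono (s :: nat \<Rightarrow> nat)"
      "\<And>n. \<not> dist (inner (y (s n)) g) (inner h g) < e"
      using not_eventually_sequentiallyD[OF e(2)] by blast
    have "bounded (range (\<lambda>n. inner (y (s n)) g))"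
      using inner_le by (auto simp: bounded_iff y_def intro!: exI[of _ "B * norm g"])
    then obtain L t where t: "strict_mono (t :: nat \<Rightarrow> nat)"
      "((\<lambda>n. inner (y (s n)) g) \<circ> t) \<longlonglongrightarrow> L"
      using bounded_imp_convergent_subsequence by blast
    have "bounded (range (y \<circ> (s \<circ> t)))"
      using assms by (rule bounded_subset) (auto simp: y_def)
    then obtain h' where h': "\<And>m. h' \<in> tail_hull (y \<circ> (s \<circ> t)) m"
      using tail_hulls_Inter_nonempty by blast
    have "inner h' g = L"
      by (rule inner_tail_hull_eq_lim[OF h']) (use t(2) in \<open>simp add: o_def\<close>)
    moreover have "h' = h" by (rule unique[OF strict_mono_o[OF s(1) t(1)] h'])
    ultimately have "(\<lambda>n. inner (y (s (t n))) g) \<longlonglongrightarrow> inner h g" using t(2) by (simp add: o_def)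
    from tendstoD[OF this e(1)] s(2) show False by (simp add: eventually_sequentially)
  qed
  then have "weakly_tendsto (x \<circ> r) h" by (simp add: weakly_tendsto_def y_def)
  with r(1) show thesis by (rule that)
qed

section \<open>Weak limits and the norm; continuity from equicontinuity\<close>

lemma weakly_tendsto_if_tendsto:
  assumes "x \<longlonglongrightarrow> h" shows "weakly_tendsto x h"
  unfolding weakly_tendsto_def by (intro allI tendsto_inner assms tendsto_const)

text \<open>Test the weak convergence against \<open>h\<close> itself, apply Cauchy-Schwarz and
  cancel one factor \<open>norm h\<close>.\<close>

lemma norm_weak_limit_le:
  assumes "weakly_tendsto x h" and B: "\<And>j. norm (x j) \<le> B"
  shows "norm h \<le> B"
proof -
  have "(\<lambda>j. inner (x j) h) \<longlonglongrightarrow> inner h h"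
    using assms(1) by (simp add: weakly_tendsto_def)
  moreover have "inner (x j) h \<le> B * norm h" for j
    by (rule order_trans[OF norm_cauchy_schwarz mult_right_mono[OF B norm_ge_zero]])
  ultimately have "inner h h \<le> B * norm h" by (intro LIMSEQ_le_const2) auto
  then have "norm h * norm h \<le> B * norm h" by (simp add: dot_square_norm power2_eq_square)
  moreover have "0 \<le> B" using order_trans[OF norm_ge_zero B] .
  ultimately show ?thesis by (cases "norm h = 0") (auto simp: mult_le_cancel_right)
qed

text \<open>Supplies the continuity in the scalar \<open>a\<close> for the intermediate value
  theorem.\<close>

lemma equicontinuous_family_on_imp_continuous_on:
  assumes "equicontinuous_family_on S N F" "n \<in> N"
  shows "continuous_on S (F n)"
  using assms unfolding equicontinuous_family_on_def continuous_on_iff by blast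

section \<open>Upper bound for the approximating energies\<close>

text \<open>Here \<open>h0 n\<close> and \<open>q n\<close> stand for the approximations of
  \<open>h\<close> and of the direction \<open>p\<close>. It suffices to treat bounds
  \<open>c\<close> above the energy of a single control \<open>h\<close>, since the infimum is
  approached by such controls.\<close>

lemma eventually_min_energy_less:
  fixes X :: "nat \<Rightarrow> 'h::real_inner set" and \<Upsilon>n :: "nat \<Rightarrow> 'h \<Rightarrow> 'e" and T :: "'h \<Rightarrow> real"
  assumes subspaces: "\<And>n. n \<ge> 1 \<Longrightarrow> subspace (X n)"
    and range: "\<And>n. n \<ge> 1 \<Longrightarrow> h0 n \<in> X n" "\<And>n. n \<ge> 1 \<Longrightarrow> q n \<in> X n"
    and lim: "h0 \<longlonglongrightarrow> h" "q \<longlonglongrightarrow> p"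
    and stable: "\<And>a. (\<lambda>n. \<Phi> (\<Upsilon>n n (h0 n + a *\<^sub>R q n))) \<longlonglongrightarrow> T (h + a *\<^sub>R p)"
    and cont: "\<And>n a0. n \<ge> 1 \<Longrightarrow> a0 > 0 \<Longrightarrow>
      continuous_on {-a0..a0} (\<lambda>a. \<Phi> (\<Upsilon>n n (h0 n + a *\<^sub>R q n)))"
    and der: "((\<lambda>a. T (h + a *\<^sub>R p)) has_real_derivative D) (at 0)" "D > 0"
    and less: "ennreal (1/2 * (norm h)\<^sup>2) < c"
  shows "\<forall>\<^sub>F n in sequentially. min_energy (X n) (\<Upsilon>n n) \<Phi> (T h) < c"
proof -
  \<comment> \<open>\<open>norm h + a * norm p\<close> bounds the norm on the whole segment from
    \<open>h - a p\<close> to \<open>h + a p\<close>, so \<open>a\<close> can be fixed before the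
    crossing point is known.\<close>
  have "((\<lambda>a. ennreal (1/2 * (norm h + a * norm p)\<^sup>2)) \<longlongrightarrow> ennreal (1/2 * (norm h + 0 * norm p)\<^sup>2)) (at_right 0)"
    by (intro tendsto_intros)
  then have small: "\<forall>\<^sub>F a in at_right 0. ennreal (1/2 * (norm h + a * norm p)\<^sup>2) < c"
    by (rule order_tendstoD(2)) (use less in simp)
  obtain d1 where d1: "d1 > 0" "\<And>a. 0 < a \<Longrightarrow> a < d1 \<Longrightarrow> T h < T (h + a *\<^sub>R p)"
    using DERIV_pos_inc_right[OF der] by auto
  obtain d2 where d2: "d2 > 0" "\<And>a. 0 < a \<Longrightarrow> a < d2 \<Longrightarrow> T (h + (- a) *\<^sub>R p) < T h"
    using DERIV_pos_inc_left[OF der] by auto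
  have "\<forall>\<^sub>F a in at_right 0. a \<in> {0<..<min d1 d2}"
    using d1(1) d2(1) by (intro eventually_at_right_real) auto
  then obtain a where a: "0 < a" "a < d1" "a < d2" "ennreal (1/2 * (norm h + a * norm p)\<^sup>2) < c"
    using eventually_happens'[OF _ eventually_conj[OF small, of "\<lambda>a. a \<in> {0<..<min d1 d2}"]] by auto
  have up: "\<forall>\<^sub>F n in sequentially. T h < \<Phi> (\<Upsilon>n n (h0 n + a *\<^sub>R q n))"
    using order_tendstoD(1)[OF stable d1(2)] a by blast
  have dn: "\<forall>\<^sub>F n in sequentially. \<Phi> (\<Upsilon>n n (h0 n + (- a) *\<^sub>R q n)) < T h"
    using order_tendstoD(2)[OF stable d2(2)] a by blast
  have "(\<lambda>n. ennreal (1/2 * (norm (h0 n) + a * norm (q n))\<^sup>2)) \<longlonglongrightarrow> ennreal (1/2 * (norm h + a * norm p)\<^sup>2)"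
    by (intro tendsto_intros lim)
  then have en: "\<forall>\<^sub>F n in sequentially. ennreal (1/2 * (norm (h0 n) + a * norm (q n))\<^sup>2) < c"
    by (rule order_tendstoD(2)) (rule a(4))
  show ?thesis
    using up dn en eventually_ge_at_top[of 1]
  proof eventually_elim
    case (elim n)
    \<comment> \<open>The crossing scalar \<open>b\<close> varies with \<open>n\<close>, but the
      energy bound \<open>en\<close> covers all of \<open>[-a, a]\<close>.\<close>
    obtain b where b: "-a \<le> b" "b \<le> a" "\<Phi> (\<Upsilon>n n (h0 n + b *\<^sub>R q n)) = T h"
      using IVT'[of "\<lambda>b. \<Phi> (\<Upsilon>n n (h0 n + b *\<^sub>R q n))" "-a" "T h" a] elim a cont[of n a] by auto
    have "\<bar>b\<bar> * norm (q n) \<le> a * norm (q n)" using b by (intro mult_right_mono) auto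
    then have norm_le: "norm (h0 n + b *\<^sub>R q n) \<le> norm (h0 n) + a * norm (q n)"
      using norm_triangle_ineq[of "h0 n" "b *\<^sub>R q n"] by simp
    have "h0 n + b *\<^sub>R q n \<in> X n"
      using subspaces range elim by (simp add: subspace_add subspace_scale)
    then have "min_energy (X n) (\<Upsilon>n n) \<Phi> (T h) \<le> ennreal (1/2 * (norm (h0 n + b *\<^sub>R q n))\<^sup>2)"
      unfolding min_energy_def using b by (intro INF_lower) auto
    also have "\<dots> \<le> ennreal (1/2 * (norm (h0 n) + a * norm (q n))\<^sup>2)"
      using norm_le by (intro ennreal_leI mult_left_mono power_mono) auto
    also have "\<dots> < c" using elim by blast
    finally show ?case .
  qed
qed

section \<open>Lower bound for the approximating energies\<close>

lemma eventually_min_energy_greater: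
  fixes X :: "nat \<Rightarrow> 'h::{real_inner, complete_space} set" and \<Upsilon>n :: "nat \<Rightarrow> 'h \<Rightarrow> 'e::metric_space"
  assumes cont: "continuous_on UNIV \<Phi>"
    and stable: "\<And>(nj :: nat \<Rightarrow> nat) (hj :: nat \<Rightarrow> 'h) h.
          filterlim nj at_top sequentially \<Longrightarrow>
          (\<And>j. nj j \<ge> 1 \<and> hj j \<in> X (nj j)) \<Longrightarrow>
          weakly_tendsto hj h \<Longrightarrow>
          (\<lambda>j. \<Upsilon>n (nj j) (hj j)) \<longlonglongrightarrow> \<Upsilon> h"
    and less: "c < min_energy UNIV \<Upsilon> \<Phi> y"
  shows "\<forall>\<^sub>F n in sequentially. c < min_energy (X n) (\<Upsilon>n n) \<Phi> y"
proof (rule ccontr)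
  assume "\<not> ?thesis"
  then obtain r0 where r0: "strict_mono (r0 :: nat \<Rightarrow> nat)"
    "\<And>j. \<not> c < min_energy (X (r0 j)) (\<Upsilon>n (r0 j)) \<Phi> y"
    using not_eventually_sequentiallyD by blast
  \<comment> \<open>The shift makes every index at least 1, as \<open>stable\<close>
    demands.\<close>
  define r where "r = r0 \<circ> Suc"
  have r: "strict_mono r" using r0(1) by (simp add: r_def strict_mono_def)
  have r1: "r j \<ge> 1" for j
    using strict_mono_imp_increasing[OF r0(1), of "Suc j"] by (simp add: r_def)
  \<comment> \<open>The gap between \<open>c\<close> and \<open>c'\<close> yields controls of energy
    below \<open>c'\<close> even if the infima are not attained. Lying below another value,
    \<open>c'\<close> is finite, so these controls are bounded.\<close>
  obtain c' where c': "c < c'" "c' < min_energy UNIV \<Upsilon> \<Phi> y" using less dense by blast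
  then obtain R where R: "c' = ennreal R" "R \<ge> 0"
    by (metis ennreal_cases not_less_iff_gr_or_eq top_greatest order.strict_trans2)
  have "\<exists>h. h \<in> X (r j) \<and> \<Phi> (\<Upsilon>n (r j) h) = y \<and> ennreal (1/2 * (norm h)\<^sup>2) < c'" for j
  proof -
    have "min_energy (X (r j)) (\<Upsilon>n (r j)) \<Phi> y < c'"
      using r0(2)[of "Suc j"] c'(1) by (simp add: r_def)
    then show ?thesis unfolding min_energy_def by (auto simp: INF_less_iff)
  qed
  then obtain x where x: "\<And>j. x j \<in> X (r j)" "\<And>j. \<Phi> (\<Upsilon>n (r j) (x j)) = y"
    "\<And>j. ennreal (1/2 * (norm (x j))\<^sup>2) < c'"
    by metis
  have x_le: "norm (x j) \<le> sqrt (2 * R)" for j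
  proof (rule real_le_rsqrt)
    have "1/2 * (norm (x j))\<^sup>2 < R" using x(3)[of j] by (simp add: R(1) ennreal_less_iff)
    then show "(norm (x j))\<^sup>2 \<le> 2 * R" by simp
  qed
  then have "bounded (range x)" by (auto simp: bounded_iff)
  then obtain s h where s: "strict_mono (s :: nat \<Rightarrow> nat)" "weakly_tendsto (x \<circ> s) h"
    by (rule bounded_imp_weakly_convergent_subseq)
  have "(\<lambda>j. \<Upsilon>n ((r \<circ> s) j) ((x \<circ> s) j)) \<longlonglongrightarrow> \<Upsilon> h"
    using filterlim_subseq[OF strict_mono_o[OF r s(1)]] _ s(2)
    by (rule stable) (use x(1) r1 in auto)
  then have "(\<lambda>j. \<Phi> (\<Upsilon>n ((r \<circ> s) j) ((x \<circ> s) j))) \<longlonglongrightarrow> \<Phi> (\<Upsilon> h)"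
    by (rule continuous_on_tendsto_compose[OF cont]) auto
  then have "\<Phi> (\<Upsilon> h) = y" by (simp add: x(2) LIMSEQ_const_iff)
  then have "min_energy UNIV \<Upsilon> \<Phi> y \<le> ennreal (1/2 * (norm h)\<^sup>2)"
    unfolding min_energy_def by (intro INF_lower) auto
  moreover have "norm h \<le> sqrt (2 * R)"
    by (rule norm_weak_limit_le[OF s(2)]) (simp add: x_le)
  then have "(norm h)\<^sup>2 \<le> 2 * R"
    using R(2) power_mono[of "norm h" "sqrt (2 * R)" 2] by simp
  then have "ennreal (1/2 * (norm h)\<^sup>2) \<le> c'"
    unfolding R(1) by (intro ennreal_leI) simp
  ultimately show False using c'(2) by simp
qed

section \<open>Convergence of the minimal energies in the order topology of
  \<open>[0, \<infinity>]\<close>\<close>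

theorem theorem1:
  fixes X :: "nat \<Rightarrow> 'h::{real_inner, complete_space} set"
    and \<Upsilon> :: "'h \<Rightarrow> 'e::metric_space"
    and \<Upsilon>n :: "nat \<Rightarrow> 'h \<Rightarrow> 'e"
    and \<Phi> :: "'e \<Rightarrow> real"
    and Q :: "nat \<Rightarrow> 'h \<Rightarrow> 'h"
  assumes subspaces: "\<And>n. n \<ge> 1 \<Longrightarrow> subspace (X n)"
    and cont_obs: "continuous_on UNIV \<Phi>"
    and compactness: "\<And>R::real. R > 0 \<Longrightarrow>
          relatively_compact {\<Upsilon>n n h | n h. n \<ge> 1 \<and> h \<in> X n \<and> norm h \<le> R}"
    and weak_stability: "\<And>(nj :: nat \<Rightarrow> nat) (hj :: nat \<Rightarrow> 'h) h.
          filterlim nj at_top sequentially \<Longrightarrow>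
          (\<And>j. nj j \<ge> 1 \<and> hj j \<in> X (nj j)) \<Longrightarrow>
          weakly_tendsto hj h \<Longrightarrow>
          (\<lambda>j. \<Upsilon>n (nj j) (hj j)) \<longlonglongrightarrow> \<Upsilon> h"
    and approx_range: "\<And>n h. n \<ge> 1 \<Longrightarrow> Q n h \<in> X n"
    and approx_conv: "\<And>h. (\<lambda>n. Q n h) \<longlonglongrightarrow> h"
    and equicontinuity: "\<And>(h0 :: nat \<Rightarrow> 'h) h q (a0::real).
          (\<And>n. n \<ge> 1 \<Longrightarrow> h0 n \<in> X n) \<Longrightarrow>
          h0 \<longlonglongrightarrow> h \<Longrightarrow>
          a0 > 0 \<Longrightarrow>
          equicontinuous_family_on {-a0..a0} {1..}
            (\<lambda>n a. \<Phi> (\<Upsilon>n n (h0 n + a *\<^sub>R Q n q)))"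
    and C1: "continuously_differentiable (\<lambda>h. \<Phi> (\<Upsilon> h))"
    and nondegenerate: "\<And>h. \<exists>q. frechet_derivative (\<lambda>h. \<Phi> (\<Upsilon> h)) (at h) q \<noteq> 0"
  shows "\<forall>y. (\<lambda>n. min_energy (X n) (\<Upsilon>n n) \<Phi> y) \<longlonglongrightarrow> min_energy UNIV \<Upsilon> \<Phi> y"
proof
  fix y
  let ?T = "\<lambda>h. \<Phi> (\<Upsilon> h)"
  show "(\<lambda>n. min_energy (X n) (\<Upsilon>n n) \<Phi> y) \<longlonglongrightarrow> min_energy UNIV \<Upsilon> \<Phi> y"
  \<comment> \<open>This also covers an infinite limit energy: the lower bound alone then gives
    convergence, the upper case being vacuous.\<close>
  proof (rule order_tendstoI)
    fix c assume "c < min_energy UNIV \<Upsilon> \<Phi> y"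
    with cont_obs weak_stability
    show "\<forall>\<^sub>F n in sequentially. c < min_energy (X n) (\<Upsilon>n n) \<Phi> y"
      by (rule eventually_min_energy_greater)
  next
    fix c assume "min_energy UNIV \<Upsilon> \<Phi> y < c"
    then obtain h where h: "?T h = y" "ennreal (1/2 * (norm h)\<^sup>2) < c"
      unfolding min_energy_def by (auto simp: INF_less_iff)
    have "?T differentiable at h"
      using C1 by (auto simp: continuously_differentiable_def differentiable_def)
    then have der: "(?T has_derivative frechet_derivative ?T (at h)) (at h)"
      by (simp add: frechet_derivative_works)
    then interpret D: bounded_linear "frechet_derivative ?T (at h)"
      by (rule has_derivative_bounded_linear)
    \<comment> \<open>A nonzero derivative in direction \<open>q\<close> is made positive by passing
      to \<open>- q\<close> if necessary.\<close>
    obtain p where p: "frechet_derivative ?T (at h) p > 0"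
    proof -
      obtain q where "frechet_derivative ?T (at h) q \<noteq> 0" using nondegenerate by blast
      then have "frechet_derivative ?T (at h) q > 0 \<or> frechet_derivative ?T (at h) (- q) > 0"
        by (auto simp: D.neg)
      then show thesis using that by blast
    qed
    have "((\<lambda>a. h + a *\<^sub>R p) has_derivative (\<lambda>a. a *\<^sub>R p)) (at (0::real))"
      by (auto intro!: derivative_eq_intros)
    then have "((\<lambda>a. ?T (h + a *\<^sub>R p)) has_derivative
        (\<lambda>a. frechet_derivative ?T (at h) (a *\<^sub>R p))) (at 0)"
      by (rule has_derivative_compose) (simp add: der)
    then have line: "((\<lambda>a. ?T (h + a *\<^sub>R p)) has_real_derivative frechet_derivative ?T (at h) p) (at 0)"
      by (simp add: has_field_derivative_def D.scaleR mult_commute_abs)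
    have "\<forall>\<^sub>F n in sequentially. min_energy (X n) (\<Upsilon>n n) \<Phi> (?T h) < c"
    proof (rule eventually_min_energy_less[where T = ?T, OF subspaces
          approx_range approx_range approx_conv approx_conv _ _ line p h(2)])
      show "(\<lambda>n. \<Phi> (\<Upsilon>n n (Q n h + a *\<^sub>R Q n p))) \<longlonglongrightarrow> ?T (h + a *\<^sub>R p)" for a
      proof -
        have "(\<lambda>n. Q n h + a *\<^sub>R Q n p) \<longlonglongrightarrow> h + a *\<^sub>R p"
          by (intro tendsto_intros approx_conv)
        \<comment> \<open>The sequence starts at \<open>Suc n\<close> because the range of
          \<open>Q n\<close> is controlled from index 1 on; weak stability is applied with
          \<open>nj = Suc\<close>.\<close>
        then have "weakly_tendsto (\<lambda>n. Q (Suc n) h + a *\<^sub>R Q (Suc n) p) (h + a *\<^sub>R p)"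
          by (intro weakly_tendsto_if_tendsto LIMSEQ_Suc)
        then have "(\<lambda>n. \<Upsilon>n (Suc n) (Q (Suc n) h + a *\<^sub>R Q (Suc n) p)) \<longlonglongrightarrow> \<Upsilon> (h + a *\<^sub>R p)"
          by (intro weak_stability filterlim_Suc)
            (simp_all add: subspaces approx_range subspace_add subspace_scale)
        then have "(\<lambda>n. \<Phi> (\<Upsilon>n (Suc n) (Q (Suc n) h + a *\<^sub>R Q (Suc n) p))) \<longlonglongrightarrow> ?T (h + a *\<^sub>R p)"
          by (rule continuous_on_tendsto_compose[OF cont_obs]) auto
        then show ?thesis by (rule LIMSEQ_imp_Suc)
      qed
      show "continuous_on {-a0..a0} (\<lambda>a. \<Phi> (\<Upsilon>n n (Q n h + a *\<^sub>R Q n p)))"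
        if "n \<ge> 1" "a0 > 0" for n a0
        using equicontinuous_family_on_imp_continuous_on[OF
            equicontinuity[OF approx_range approx_conv \<open>a0 > 0\<close>], of n] that by simp
    qed auto
    with h(1) show "\<forall>\<^sub>F n in sequentially. min_energy (X n) (\<Upsilon>n n) \<Phi> y < c" by simp
  qed
qed

end
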